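(* Let $n\geq 1$ be an integer. With positive probability, the aggregate $A_n^*[\infty]$ does not intersect the axis $\mathbb{Z}\times\{0\}$.
   Context: Let $(S_{i,j})_{i\in\mathbb{Z},j\geq1}$ be independent simple symmetric random walks on $\mathbb{Z}^2$, $S_{i,j}$ starting at $(0,i)$, and let $(N_i)_{i\in\mathbb{Z}}$ be i.i.d. Poisson random variables with parameter $n$, independent of the walks. When the current aggregate is $A\subset\mathbb{Z}^2$, sending particle $(i,j)$ (from level $i$) means: follow $S_{i,j}$ until the first time (possibly time $0$) it is at a site $z\notin A$; the particle stops there and the aggregate becomes $A\cup\{z\}$. $A_n^*[M]$ ($M\geq0$) is the aggregate obtained from $\emptyset$ by sending $N_i$ particles from each level $i$ with $|i|\leq M$, levels being treated in the usual order $0,1,-1,2,-2,\dots,M,-M$; $A_n^*[\infty]=\bigcup_{M\geq0}A_n^*[M]$ (increasing union). *)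

theory Defs
  imports "HOL-Probability.Probability"
begin

definition unit_steps :: "(int \<times> int) set" where
  "unit_steps = {(1, 0), (-1, 0), (0, 1), (0, -1)}"

definition (in prob_space) simple_random_walk ::
    "(nat \<Rightarrow> 'a \<Rightarrow> int \<times> int) \<Rightarrow> int \<times> int \<Rightarrow> bool" where
  "simple_random_walk X x \<longleftrightarrow>
     (\<forall>t. random_variable (count_space UNIV) (X t)) \<and>
     (AE \<omega> in M. X 0 \<omega> = x) \<and>
     indep_vars (\<lambda>_. count_space UNIV) (\<lambda>t \<omega>. X (Suc t) \<omega> - X t \<omega>) UNIV \<and>
     (\<forall>t. distr M (count_space UNIV) (\<lambda>\<omega>. X (Suc t) \<omega> - X t \<omega>)
            = measure_pmf (pmf_of_set unit_steps))"

abbreviation path_space :: "(nat \<Rightarrow> int \<times> int) measure" where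
  "path_space \<equiv> PiM UNIV (\<lambda>_. count_space UNIV)"

text \<open>Particles are indexed by pairs (level, rank) with rank at least 1.\<close>

abbreviation particles :: "(int \<times> nat) set" where
  "particles \<equiv> UNIV \<times> {1..}"

text \<open>A path that never leaves the aggregate leaves it unchanged. The aggregates below are finite
  at every step, so for the random walks this only happens on a null event.\<close>

definition send :: "(nat \<Rightarrow> int \<times> int) \<Rightarrow> (int \<times> int) set \<Rightarrow> (int \<times> int) set" where
  "send w A = (if \<exists>t. w t \<notin> A then insert (w (LEAST t. w t \<notin> A)) A else A)"

definition send_level ::
    "(int \<Rightarrow> nat \<Rightarrow> nat \<Rightarrow> int \<times> int) \<Rightarrow> (int \<Rightarrow> nat) \<Rightarrow> int \<Rightarrow> (int \<times> int) set \<Rightarrow> (int \<times> int) set" where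
  "send_level w k i A = fold (\<lambda>j. send (w i j)) [1..<Suc (k i)] A"

primrec aggregate ::
    "(int \<Rightarrow> nat \<Rightarrow> nat \<Rightarrow> int \<times> int) \<Rightarrow> (int \<Rightarrow> nat) \<Rightarrow> nat \<Rightarrow> (int \<times> int) set" where
  "aggregate w k 0 = send_level w k 0 {}"
| "aggregate w k (Suc m) =
     send_level w k (- int (Suc m)) (send_level w k (int (Suc m)) (aggregate w k m))"

definition aggregate_inf ::
    "(int \<Rightarrow> nat \<Rightarrow> nat \<Rightarrow> int \<times> int) \<Rightarrow> (int \<Rightarrow> nat) \<Rightarrow> (int \<times> int) set" where
  "aggregate_inf w k = (\<Union>m. aggregate w k m)"

end

theory Submission
  imports Defs
begin

text \<open>A particle from level \<open>i\<close> that stops on the axis has stayed, until then, in an aggregate \<open>A\<close> of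
  at most \<open>C\<bar>i\<bar>\<close> sites, provided that at most \<open>C\<bar>i\<bar>\<close> particles start from the levels up to \<open>\<bar>i\<bar>\<close>.
  It has to cross every level in between, and on a level that contains \<open>s\<close> sites of \<open>A\<close> it leaves \<open>A\<close>
  with probability at least \<open>4\<^sup>-\<^sup>s\<close> by walking straight to the right. As \<open>s\<close> is at most \<open>C\<close> on average,
  convexity bounds the probability of arrival by \<open>exp (- \<bar>i\<bar> / 4\<^sup>C)\<close>. Conditionally on the numbers
  of particles, a union bound over all particles then gives at most \<open>1/2\<close> if the levels up to a
  large \<open>L\<close> are empty, and by a Chernoff bound the numbers are empty there and satisfy the linear
  growth condition with positive probability.\<close>

section \<open>Walks killed on leaving a finite set\<close>

text \<open>The walk enters as a start and a sequence of increments, so that the recursion can drop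
  the first increment and independence applies directly. The axis is tested before \<open>A\<close>:
  the site of arrival may lie outside \<open>A\<close>.\<close>

primrec reach :: "(int \<times> int) set \<Rightarrow> nat \<Rightarrow> int \<times> int \<Rightarrow> (nat \<Rightarrow> int \<times> int) \<Rightarrow> bool" where
  "reach A 0 x \<xi> \<longleftrightarrow> snd x = 0"
| "reach A (Suc T) x \<xi> \<longleftrightarrow> snd x = 0 \<or> x \<in> A \<and> reach A T (x + \<xi> 0) (\<lambda>t. \<xi> (Suc t))"

text \<open>First-step analysis of the probability of \<open>reach\<close> as a purely arithmetic
  recursion. The estimates are carried out on it without measure theory; \<open>prob_reach\<close>
  makes the identification.\<close>

primrec reach_prob :: "(int \<times> int) set \<Rightarrow> nat \<Rightarrow> int \<times> int \<Rightarrow> real" where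
  "reach_prob A 0 x = (if snd x = 0 then 1 else 0)"
| "reach_prob A (Suc T) x =
     (if snd x = 0 then 1 else if x \<notin> A then 0
      else (\<Sum>e\<in>unit_steps. reach_prob A T (x + e)) / 4)"

lemma sum_unit_steps:
  "(\<Sum>e\<in>unit_steps. f e) = f (1, 0) + f (-1, 0) + f (0, 1) + f (0, -1)"
  for f :: "int \<times> int \<Rightarrow> 'b::comm_monoid_add"
  by (simp add: unit_steps_def add.assoc)

lemma abs_snd_unit_step:
  assumes "e \<in> unit_steps"
  shows "\<bar>snd x\<bar> \<le> \<bar>snd (x + e)\<bar> + 1"
  using assms by (auto simp: unit_steps_def)

lemma card_unit_steps: "card unit_steps = 4"
  by (simp add: unit_steps_def)

lemma finite_unit_steps: "finite unit_steps"
  by (simp add: unit_steps_def)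

lemma sum_unit_steps_le:
  fixes f :: "int \<times> int \<Rightarrow> real"
  assumes "\<And>e. e \<in> unit_steps \<Longrightarrow> f e \<le> B"
  shows "(\<Sum>e\<in>unit_steps. f e) / 4 \<le> B"
  using sum_bounded_above[of unit_steps f B] assms by (simp add: card_unit_steps)

lemma reach_prob_le_1: "reach_prob A T x \<le> 1"
proof (induction T arbitrary: x)
  case (Suc T)
  then have "(\<Sum>e\<in>unit_steps. reach_prob A T (x + e)) / 4 \<le> 1"
    by (intro sum_unit_steps_le)
  then show ?case by simp
qed simp

text \<open>A step changes the level by at most one, so a walk that starts at height
  \<open>k\<close> or more meets height \<open>k\<close> before the axis. The bound is assumed for
  every horizon because the time left on that occasion is arbitrary.\<close>

lemma reach_prob_max_principle:
  assumes "\<And>T x. \<bar>snd x\<bar> = k \<Longrightarrow> reach_prob A T x \<le> B" "0 < k" "0 \<le> B"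
    and "k \<le> \<bar>snd x\<bar>"
  shows "reach_prob A T x \<le> B"
  using assms(4)
proof (induction T arbitrary: x)
  case 0
  then show ?case using assms(2,3) by auto
next
  case (Suc T)
  show ?case
  proof (cases "\<bar>snd x\<bar> = k")
    case True
    then show ?thesis by (rule assms(1))
  next
    case False
    have "reach_prob A T (x + e) \<le> B" if "e \<in> unit_steps" for e
      using Suc False abs_snd_unit_step[OF that, of x] by auto
    then have "(\<Sum>e\<in>unit_steps. reach_prob A T (x + e)) / 4 \<le> B"
      by (rule sum_unit_steps_le)
    then show ?thesis using Suc.prems assms(2,3) by auto
  qed
qed

text \<open>The escape strategy: walking straight to the right for \<open>r\<close> steps has probability \<open>4\<^sup>-\<^sup>r\<close>.\<close>

lemma reach_prob_row:
  assumes "\<And>T y. k \<le> \<bar>snd y\<bar> \<Longrightarrow> reach_prob A T y \<le> B" "0 \<le> k" "0 \<le> B"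
    and "\<bar>snd x\<bar> = k + 1" "x + (int r, 0) \<notin> A"
  shows "reach_prob A T x \<le> B * (1 - (1/4) ^ r)"
  using assms(4,5)
proof (induction r arbitrary: x T)
  case 0
  then have "x \<notin> A" by (cases x) simp
  then show ?case using 0 assms(2) by (cases T) auto
next
  case (Suc r)
  \<comment> \<open>The recursion returns 0 when time is up off the axis or when \<open>x\<close> is
    not in \<open>A\<close>; a nonnegative bound settles these cases.\<close>
  have nn: "0 \<le> B * (1 - (1/4) ^ Suc r)"
    using assms(3) power_le_one[of "1/4::real" "Suc r"] by (intro mult_nonneg_nonneg) auto
  show ?case
  proof (cases T)
    case 0
    then show ?thesis using Suc.prems assms(2) nn by auto
  next
    case (Suc T')
    have "x + (1, 0) + (int r, 0) \<notin> A"
      using Suc.prems(2) by (simp add: add.assoc)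
    then have right: "reach_prob A T' (x + (1, 0)) \<le> B * (1 - (1/4) ^ r)"
      using Suc.prems(1) by (intro Suc.IH) auto
    \<comment> \<open>All neighbours of a site at height \<open>k + 1\<close> have height at least
      \<open>k\<close>, where \<open>B\<close> is available. The gain comes from the step to the
      right alone.\<close>
    have other: "reach_prob A T' (x + e) \<le> B" if "e \<in> unit_steps" for e
      using assms(1) Suc.prems(1) abs_snd_unit_step[OF that, of x] by simp
    have "(\<Sum>e\<in>unit_steps. reach_prob A T' (x + e)) \<le> B * (1 - (1/4) ^ r) + B + B + B"
      unfolding sum_unit_steps using right other[unfolded unit_steps_def]
      by (intro add_mono) auto
    also have "\<dots> = 4 * (B * (1 - (1/4) ^ Suc r))" by (simp add: field_simps)
    finally show ?thesis using nn Suc Suc.prems(1) assms(2) by auto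
  qed
qed

text \<open>Pigeonhole: among one more consecutive sites of a row than the count allows, some site
  is vacant. The rows on both sides of the axis are counted together, since the walk may be on
  either.\<close>

lemma ex_vacant_right:
  fixes A :: "(int \<times> int) set"
  assumes "finite A"
  shows "\<exists>r\<le>card {a \<in> A. \<bar>snd a\<bar> = \<bar>snd x\<bar>}. x + (int r, 0) \<notin> A"
proof (rule ccontr)
  define s where "s = card {a \<in> A. \<bar>snd a\<bar> = \<bar>snd x\<bar>}"
  assume "\<not> ?thesis"
  then have "(\<lambda>r. x + (int r, 0)) ` {..s} \<subseteq> {a \<in> A. \<bar>snd a\<bar> = \<bar>snd x\<bar>}"
    unfolding s_def by (intro image_subsetI) simp
  moreover have "inj_on (\<lambda>r. x + (int r, 0)) {..s}"
    by (auto simp: inj_on_def)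
  ultimately have "card {..s} \<le> card {a \<in> A. \<bar>snd a\<bar> = \<bar>snd x\<bar>}"
    using assms by (intro card_inj_on_le) auto
  then show False by (simp add: s_def)
qed

text \<open>Each level contributes one factor: \<open>reach_prob_row\<close> adds the factor of
  level \<open>Suc k\<close> to the bound already known from level \<open>k\<close> on, and the
  maximum principle carries the result to all greater heights.\<close>

lemma reach_prob_le_prod:
  assumes "finite A" "int k \<le> \<bar>snd x\<bar>"
  shows "reach_prob A T x \<le> (\<Prod>l=1..k. 1 - (1/4) ^ card {a \<in> A. \<bar>snd a\<bar> = int l})"
  using assms(2)
proof (induction k arbitrary: x T)
  case 0
  then show ?case by (simp add: reach_prob_le_1)
next
  case (Suc k)
  define B where "B = (\<Prod>l=1..k. 1 - (1/4::real) ^ card {a \<in> A. \<bar>snd a\<bar> = int l})"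
  define s where "s = card {a \<in> A. \<bar>snd a\<bar> = int (Suc k)}"
  have B: "0 \<le> B"
    unfolding B_def by (intro prod_nonneg) (simp add: power_le_one)
  have "reach_prob A T y \<le> B * (1 - (1/4) ^ s)" if y: "\<bar>snd y\<bar> = int (Suc k)" for T y
  proof -
    obtain r where r: "r \<le> s" "y + (int r, 0) \<notin> A"
      using ex_vacant_right[OF assms(1), of y] unfolding s_def y by blast
    have "reach_prob A T y \<le> B * (1 - (1/4) ^ r)"
      using Suc.IH r y B unfolding B_def by (intro reach_prob_row[where k = "int k"]) auto
    \<comment> \<open>The distance \<open>r\<close> depends on \<open>y\<close>; passing to
      \<open>s\<close> makes the bound uniform on the level, as the maximum principle
      requires.\<close>
    also have "\<dots> \<le> B * (1 - (1/4) ^ s)"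
      using r B by (intro mult_left_mono diff_left_mono power_decreasing) auto
    finally show ?thesis .
  qed
  moreover have "0 \<le> B * (1 - (1/4) ^ s)"
    using B by (intro mult_nonneg_nonneg) (simp_all add: power_le_one)
  ultimately have "reach_prob A T x \<le> B * (1 - (1/4) ^ s)"
    using Suc.prems reach_prob_max_principle[of "int (Suc k)" A "B * (1 - (1/4) ^ s)"] by simp
  then show ?case by (simp add: B_def s_def)
qed

text \<open>The tangent of \<open>s \<mapsto> 4\<^sup>-\<^sup>s\<close> at \<open>C\<close> replaces Jensen's inequality.\<close>

lemma sum_quarter_power_ge:
  assumes "(\<Sum>l\<in>I. s l) \<le> C * card I"
  shows "real (card I) * (1/4) ^ C \<le> (\<Sum>l\<in>I. (1/4) ^ s l)"
proof -
  have eq: "(1/4::real) ^ m = exp (- (real m * ln 4))" for m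
  proof -
    have "(1/4::real) ^ m = exp (- ln 4) ^ m" by (simp add: exp_minus)
    also have "\<dots> = exp (- (real m * ln 4))" by (simp add: exp_of_nat_mult[symmetric])
    finally show ?thesis .
  qed
  have tangent: "(1/4) ^ C * (1 + (real C - real m) * ln 4) \<le> (1/4) ^ m" for m
  proof -
    have "(1/4) ^ C * (1 + (real C - real m) * ln 4) \<le> (1/4) ^ C * exp ((real C - real m) * ln 4)"
      by (intro mult_left_mono exp_ge_add_one_self) auto
    also have "\<dots> = (1/4) ^ m"
      unfolding eq by (simp add: exp_add[symmetric] algebra_simps)
    finally show ?thesis .
  qed
  \<comment> \<open>Summed over \<open>I\<close>, the linear terms of the tangents are nonnegative
    because the average of \<open>s\<close> is at most \<open>C\<close>.\<close>
  have "real (card I) * (1/4) ^ C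
      \<le> (1/4) ^ C * (real (card I) + (real C * real (card I) - real (\<Sum>l\<in>I. s l)) * ln 4)"
  proof -
    have "real (\<Sum>l\<in>I. s l) \<le> real C * real (card I)"
      using assms by (metis of_nat_le_iff of_nat_mult)
    then show ?thesis by (simp add: field_simps)
  qed
  also have "\<dots> = (\<Sum>l\<in>I. (1/4) ^ C * (1 + (real C - real (s l)) * ln 4))"
    by (simp add: sum_distrib_left[symmetric] sum.distrib sum_subtractf sum_distrib_right[symmetric]
        algebra_simps)
  also have "\<dots> \<le> (\<Sum>l\<in>I. (1/4) ^ s l)"
    by (intro sum_mono tangent)
  finally show ?thesis .
qed

text \<open>The inequality \<open>1 - u \<le> exp (- u)\<close> turns the product over levels into a
  sum. The levels \<open>1..k\<close> hold at most \<open>card A\<close> sites, so their average is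
  at most \<open>C\<close> and the convexity estimate applies.\<close>

lemma reach_prob_le_exp:
  assumes "finite A" "card A \<le> C * k" "\<bar>snd x\<bar> = int k"
  shows "reach_prob A T x \<le> exp (- (real k * (1/4) ^ C))"
proof -
  define s where "s l = card {a \<in> A. \<bar>snd a\<bar> = int l}" for l
  have "(\<Sum>l=1..k. s l) = card (\<Union>l\<in>{1..k}. {a \<in> A. \<bar>snd a\<bar> = int l})"
    unfolding s_def using assms(1) by (subst card_UN_disjoint) auto
  also have "\<dots> \<le> card A" using assms(1) by (intro card_mono) auto
  finally have sum: "(\<Sum>l=1..k. s l) \<le> C * card {1..k}" using assms(2) by simp
  have "reach_prob A T x \<le> (\<Prod>l=1..k. 1 - (1/4) ^ s l)"
    unfolding s_def using assms by (intro reach_prob_le_prod) auto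
  also have "\<dots> \<le> (\<Prod>l=1..k. exp (- ((1/4) ^ s l)))"
  proof (intro prod_mono conjI)
    show "1 - (1/4) ^ s l \<le> exp (- ((1/4::real) ^ s l))" for l
      using exp_ge_add_one_self[of "- ((1/4::real) ^ s l)"] by simp
  qed (simp add: power_le_one)
  also have "\<dots> = exp (- (\<Sum>l=1..k. (1/4) ^ s l))"
    by (simp add: exp_sum[symmetric] sum_negf)
  also have "\<dots> \<le> exp (- (real k * (1/4) ^ C))"
    using sum_quarter_power_ge[OF sum] by simp
  finally show ?thesis .
qed

section \<open>Hitting the axis before leaving a finite set\<close>

text \<open>Membership in \<open>A\<close> is asked only before time \<open>t\<close>, so that a
  particle settling on the axis is covered although its final site lies outside
  \<open>A\<close>.\<close>

definition hits :: "(nat \<Rightarrow> int \<times> int) \<Rightarrow> (int \<times> int) set \<Rightarrow> bool" where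
  "hits w A \<longleftrightarrow> (\<exists>t. snd (w t) = 0 \<and> (\<forall>s<t. w s \<in> A))"

lemma measurable_hits:
  assumes "\<And>t. (\<lambda>\<omega>. w \<omega> t) \<in> M \<rightarrow>\<^sub>M count_space UNIV"
  shows "Measurable.pred M (\<lambda>\<omega>. hits (w \<omega>) A)"
proof -
  have [measurable]: "Measurable.pred M (\<lambda>\<omega>. w \<omega> t \<in> A)"
      "Measurable.pred M (\<lambda>\<omega>. snd (w \<omega> t) = 0)" for t
    by (rule measurable_compose[OF assms], simp)+
  show ?thesis unfolding hits_def by measurable
qed

lemma reach_increments:
  "reach A T (w 0) (\<lambda>t. w (Suc t) - w t) \<longleftrightarrow> (\<exists>t\<le>T. snd (w t) = 0 \<and> (\<forall>s<t. w s \<in> A))"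
proof (induction T arbitrary: w)
  case 0
  then show ?case by simp
next
  case (Suc T)
  have "reach A (Suc T) (w 0) (\<lambda>t. w (Suc t) - w t) \<longleftrightarrow> snd (w 0) = 0 \<or>
      w 0 \<in> A \<and> (\<exists>t\<le>T. snd (w (Suc t)) = 0 \<and> (\<forall>s<t. w (Suc s) \<in> A))"
    using Suc.IH[of "\<lambda>t. w (Suc t)"] by simp
  also have "\<dots> \<longleftrightarrow> snd (w 0) = 0 \<or> (\<exists>t\<le>T. snd (w (Suc t)) = 0 \<and> (\<forall>s<Suc t. w s \<in> A))"
    by (auto simp: All_less_Suc2)
  also have "\<dots> \<longleftrightarrow> (\<exists>t\<le>Suc T. snd (w t) = 0 \<and> (\<forall>s<t. w s \<in> A))"
  proof
    assume "\<exists>t\<le>Suc T. snd (w t) = 0 \<and> (\<forall>s<t. w s \<in> A)"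
    then obtain t where "t \<le> Suc T" "snd (w t) = 0" "\<forall>s<t. w s \<in> A" by blast
    then show "snd (w 0) = 0 \<or> (\<exists>t\<le>T. snd (w (Suc t)) = 0 \<and> (\<forall>s<Suc t. w s \<in> A))"
      by (cases t) auto
  qed (use Suc_le_mono in blast)
  finally show ?case .
qed

lemma hits_iff_reach: "hits w A \<longleftrightarrow> (\<exists>T. reach A T (w 0) (\<lambda>t. w (Suc t) - w t))"
  unfolding hits_def reach_increments by auto

text \<open>Makes the events increase with the horizon, so that \<open>hits\<close> has the limit of
  their probabilities.\<close>

lemma reach_mono: "reach A T x \<xi> \<Longrightarrow> T \<le> T' \<Longrightarrow> reach A T' x \<xi>"
proof (induction T arbitrary: T' x \<xi>)
  case 0
  then show ?case by (cases T') auto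
next
  case (Suc T)
  then obtain S where S: "T' = Suc S" "T \<le> S" by (cases T') auto
  then show ?case using Suc.prems Suc.IH[of "x + \<xi> 0" "\<lambda>t. \<xi> (Suc t)" S] by auto
qed

lemma measurable_reach:
  assumes "\<And>t. (\<lambda>\<omega>. \<xi> \<omega> t) \<in> M \<rightarrow>\<^sub>M count_space UNIV"
  shows "Measurable.pred M (\<lambda>\<omega>. reach A T x (\<xi> \<omega>))"
  using assms
proof (induction T arbitrary: x \<xi>)
  case 0
  then show ?case by simp
next
  case (Suc T)
  note [measurable] = Suc.prems
  have "Measurable.pred M (\<lambda>\<omega>. reach A T (x + \<xi> \<omega> 0) (\<lambda>t. \<xi> \<omega> (Suc t)))"
    \<comment> \<open>The next start is random but has countably many values, so each fixed value
      can be treated separately.\<close>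
    by (rule measurable_compose_countable[where g = "\<lambda>\<omega>. x + \<xi> \<omega> 0"])
       (auto intro!: Suc)
  then show ?case by simp
qed

text \<open>The offset \<open>u\<close> is there for the induction: after one step the walk is
  driven by the increments from \<open>Suc u\<close> on. Their independence of
  \<open>\<xi> u\<close> yields the first-step recursion.\<close>

lemma (in prob_space) prob_reach:
  assumes indep: "indep_vars (\<lambda>_. count_space UNIV) \<xi> UNIV"
    and distr: "\<And>t. distr M (count_space UNIV) (\<xi> t) = measure_pmf (pmf_of_set unit_steps)"
  shows "\<P>(\<omega> in M. reach A T x (\<lambda>t. \<xi> (u + t) \<omega>)) = reach_prob A T x"
proof (induction T arbitrary: x u)
  case 0
  then show ?case by (simp add: prob_space)
next
  case (Suc T)
  have rv [measurable]: "random_variable (count_space UNIV) (\<xi> t)" for t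
    using indep by (auto simp: indep_vars_def)
  have step: "prob (\<xi> u -` E \<inter> space M) = measure_pmf.prob (pmf_of_set unit_steps) E" for E
    using distr[of u] rv by (metis UNIV_I measure_distr sets_count_space Pow_UNIV)
  let ?R = "\<lambda>y \<omega>. reach A T y (\<lambda>t. \<xi> (Suc u + t) \<omega>)"
  have prod: "\<P>(\<omega> in M. \<xi> u \<omega> = e \<and> ?R (x + e) \<omega>) = reach_prob A T (x + e) / 4"
    if e: "e \<in> unit_steps" for e
  proof -
    \<comment> \<open>The future event is expressed through the coordinates beyond \<open>u\<close>
      alone, hence is independent of coordinate \<open>u\<close>.\<close>
    let ?S = "{f \<in> space (PiM {u<..} (\<lambda>_. count_space UNIV)). reach A T (x + e) (\<lambda>t. f (Suc u + t))}"
    have "indep_var (PiM {u} (\<lambda>_. count_space UNIV)) (\<lambda>\<omega>. restrict (\<lambda>i. \<xi> i \<omega>) {u})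
        (PiM {u<..} (\<lambda>_. count_space UNIV)) (\<lambda>\<omega>. restrict (\<lambda>i. \<xi> i \<omega>) {u<..})"
      using indep by (intro indep_var_restrict) auto
    moreover have "{f \<in> space (PiM {u} (\<lambda>_. count_space UNIV)). f u = e}
        \<in> sets (PiM {u} (\<lambda>_. count_space UNIV))"
      by measurable
    moreover have "?S \<in> sets (PiM {u<..} (\<lambda>_. count_space UNIV))"
      by (intro predE measurable_reach) measurable
    ultimately have "prob ((\<lambda>\<omega>. (restrict (\<lambda>i. \<xi> i \<omega>) {u}, restrict (\<lambda>i. \<xi> i \<omega>) {u<..}))
          -` ({f \<in> space (PiM {u} (\<lambda>_. count_space UNIV)). f u = e} \<times> ?S) \<inter> space M)
        = prob ((\<lambda>\<omega>. restrict (\<lambda>i. \<xi> i \<omega>) {u})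
            -` {f \<in> space (PiM {u} (\<lambda>_. count_space UNIV)). f u = e} \<inter> space M)
        * prob ((\<lambda>\<omega>. restrict (\<lambda>i. \<xi> i \<omega>) {u<..}) -` ?S \<inter> space M)"
      by (rule indep_varD)
    also have "(\<lambda>\<omega>. (restrict (\<lambda>i. \<xi> i \<omega>) {u}, restrict (\<lambda>i. \<xi> i \<omega>) {u<..}))
          -` ({f \<in> space (PiM {u} (\<lambda>_. count_space UNIV)). f u = e} \<times> ?S) \<inter> space M
        = {\<omega> \<in> space M. \<xi> u \<omega> = e \<and> ?R (x + e) \<omega>}"
      by (auto simp: space_PiM)
    also have "(\<lambda>\<omega>. restrict (\<lambda>i. \<xi> i \<omega>) {u})
            -` {f \<in> space (PiM {u} (\<lambda>_. count_space UNIV)). f u = e} \<inter> space M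
        = \<xi> u -` {e} \<inter> space M"
      by (auto simp: space_PiM)
    also have "(\<lambda>\<omega>. restrict (\<lambda>i. \<xi> i \<omega>) {u<..}) -` ?S \<inter> space M = {\<omega> \<in> space M. ?R (x + e) \<omega>}"
      by (auto simp: space_PiM)
    also have "prob (\<xi> u -` {e} \<inter> space M) = 1 / 4"
      unfolding step using e finite_unit_steps
      by (subst measure_pmf_of_set) (auto simp: card_unit_steps)
    finally show ?thesis using Suc.IH[of "x + e" "Suc u"] by simp
  qed
  show ?case
  proof (cases "snd x = 0 \<or> x \<notin> A")
    case True
    then show ?thesis by (auto simp: prob_space)
  next
    case False
    \<comment> \<open>Increments lie in \<open>unit_steps\<close> only almost surely, so the split
      into four cases holds up to a null event.\<close>
    have AE: "AE \<omega> in M. \<xi> u \<omega> \<in> unit_steps"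
    proof -
      have "prob (\<xi> u -` unit_steps \<inter> space M) = 1"
        unfolding step using finite_unit_steps
        by (subst measure_pmf_of_set) (auto simp: unit_steps_def)
      then show ?thesis
        by (subst (asm) prob_eq_1) auto
    qed
    have reach_eq: "reach A (Suc T) x (\<lambda>t. \<xi> (u + t) \<omega>) \<longleftrightarrow> ?R (x + \<xi> u \<omega>) \<omega>" for \<omega>
      using False by simp
    have [measurable]: "Measurable.pred M (?R y)" for y
      by (intro measurable_reach) auto
    have [measurable]: "Measurable.pred M (\<lambda>\<omega>. ?R (x + \<xi> u \<omega>) \<omega>)"
      by (rule measurable_compose_countable[where g = "\<xi> u", OF _ rv]) measurable
    have "\<P>(\<omega> in M. reach A (Suc T) x (\<lambda>t. \<xi> (u + t) \<omega>)) = \<P>(\<omega> in M. ?R (x + \<xi> u \<omega>) \<omega>)"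
      unfolding reach_eq ..
    also have "\<dots> = prob (\<Union>e\<in>unit_steps. {\<omega> \<in> space M. \<xi> u \<omega> = e \<and> ?R (x + e) \<omega>})"
    proof (rule finite_measure_eq_AE)
      show "AE \<omega> in M. \<omega> \<in> {\<omega> \<in> space M. ?R (x + \<xi> u \<omega>) \<omega>} \<longleftrightarrow>
          \<omega> \<in> (\<Union>e\<in>unit_steps. {\<omega> \<in> space M. \<xi> u \<omega> = e \<and> ?R (x + e) \<omega>})"
        using AE by eventually_elim auto
      show "{\<omega> \<in> space M. ?R (x + \<xi> u \<omega>) \<omega>} \<in> events" by measurable
      show "(\<Union>e\<in>unit_steps. {\<omega> \<in> space M. \<xi> u \<omega> = e \<and> ?R (x + e) \<omega>}) \<in> events"
        using finite_unit_steps by (rule sets.finite_UN) measurable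
    qed
    also have "\<dots> = (\<Sum>e\<in>unit_steps. \<P>(\<omega> in M. \<xi> u \<omega> = e \<and> ?R (x + e) \<omega>))"
    proof (rule finite_measure_finite_Union)
      have "{\<omega> \<in> space M. \<xi> u \<omega> = e \<and> ?R (x + e) \<omega>} \<in> events" for e by measurable
      then show "(\<lambda>e. {\<omega> \<in> space M. \<xi> u \<omega> = e \<and> ?R (x + e) \<omega>}) ` unit_steps \<subseteq> events"
        by blast
    qed (auto simp: finite_unit_steps disjoint_family_on_def)
    also have "\<dots> = (\<Sum>e\<in>unit_steps. reach_prob A T (x + e)) / 4"
      unfolding sum_divide_distrib by (intro sum.cong refl prod)
    finally show ?thesis using False by simp
  qed
qed

text \<open>The estimate for a finite horizon does not depend on the horizon and therefore survives
  the limit.\<close>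

lemma (in prob_space) prob_hits_le:
  assumes walk: "simple_random_walk X (0, i)"
    and "finite A" "card A \<le> C * nat \<bar>i\<bar>"
  shows "\<P>(\<omega> in M. hits (\<lambda>t. X t \<omega>) A) \<le> exp (- (real (nat \<bar>i\<bar>) * (1/4) ^ C))"
proof -
  have [measurable]: "random_variable (count_space UNIV) (X t)" for t
    using walk by (simp add: simple_random_walk_def)
  have AE: "AE \<omega> in M. X 0 \<omega> = (0, i)"
    and indep: "indep_vars (\<lambda>_. count_space UNIV) (\<lambda>t \<omega>. X (Suc t) \<omega> - X t \<omega>) UNIV"
    and distr: "\<And>t. distr M (count_space UNIV) (\<lambda>\<omega>. X (Suc t) \<omega> - X t \<omega>)
            = measure_pmf (pmf_of_set unit_steps)"
    using walk by (simp_all add: simple_random_walk_def)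
  let ?E = "\<lambda>T. {\<omega> \<in> space M. reach A T (0, i) (\<lambda>t. X (Suc t) \<omega> - X t \<omega>)}"
  have E: "?E T \<in> events" for T
    by (intro predE measurable_reach) measurable
  have "prob (?E T) = reach_prob A T (0, i)" for T
    using prob_reach[OF indep distr, of A T "(0, i)" 0] by simp
  then have le: "prob (?E T) \<le> exp (- (real (nat \<bar>i\<bar>) * (1/4) ^ C))" for T
    using reach_prob_le_exp[OF assms(2,3), of "(0, i)" T] by simp
  \<comment> \<open>The start is \<open>(0, i)\<close> only almost surely, so the two events agree
    up to a null event.\<close>
  have "\<P>(\<omega> in M. hits (\<lambda>t. X t \<omega>) A) = prob (\<Union>T. ?E T)"
  proof (rule finite_measure_eq_AE)
    show "{\<omega> \<in> space M. hits (\<lambda>t. X t \<omega>) A} \<in> events"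
      by (intro predE measurable_hits) measurable
    show "AE \<omega> in M. \<omega> \<in> {\<omega> \<in> space M. hits (\<lambda>t. X t \<omega>) A} \<longleftrightarrow> \<omega> \<in> (\<Union>T. ?E T)"
      using AE by eventually_elim (auto simp: hits_iff_reach)
  qed (use E in blast)
  moreover have "(\<lambda>T. prob (?E T)) \<longlonglongrightarrow> prob (\<Union>T. ?E T)"
    using E by (intro finite_Lim_measure_incseq) (auto simp: incseq_def intro: reach_mono)
  ultimately show ?thesis
    using le by (intro LIMSEQ_le_const2) auto
qed

section \<open>Sending a list of particles\<close>

text \<open>Fubini: the joint law of \<open>X\<close> and \<open>Y\<close> is a product, and each
  fibre over \<open>y\<close> is bounded by \<open>b\<close>. Independence is stated as a product
  rule for preimages because this form follows both from \<open>indep_var\<close> and from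
  \<open>indep_set\<close>, and both occur below.\<close>

lemma (in prob_space) prob_fibre_bound:
  assumes X [measurable]: "random_variable S X" and Y [measurable]: "random_variable T Y"
    and indep: "\<And>A B. A \<in> sets S \<Longrightarrow> B \<in> sets T \<Longrightarrow>
      prob ((X -` A \<inter> space M) \<inter> (Y -` B \<inter> space M))
        = prob (X -` A \<inter> space M) * prob (Y -` B \<inter> space M)"
    and B: "{z \<in> space (S \<Otimes>\<^sub>M T). R (fst z) (snd z)} \<in> sets (S \<Otimes>\<^sub>M T)"
    and E: "{y \<in> space T. Q y} \<in> sets T"
    and bound: "\<And>y. y \<in> space T \<Longrightarrow> Q y \<Longrightarrow> \<P>(\<omega> in M. R (X \<omega>) y) \<le> b" and b: "0 \<le> b"
  shows "\<P>(\<omega> in M. R (X \<omega>) (Y \<omega>) \<and> Q (Y \<omega>)) \<le> b * \<P>(\<omega> in M. Q (Y \<omega>))"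
proof -
  interpret SX: prob_space "distr M S X" by (rule prob_space_distr) (rule X)
  interpret TY: prob_space "distr M T Y" by (rule prob_space_distr) (rule Y)
  interpret pair_sigma_finite "distr M S X" "distr M T Y" ..
  have eq: "distr M S X \<Otimes>\<^sub>M distr M T Y = distr M (S \<Otimes>\<^sub>M T) (\<lambda>x. (X x, Y x))"
  proof (rule pair_measure_eqI)
    fix A B assume "A \<in> sets (distr M S X)" "B \<in> sets (distr M T Y)"
    then have A: "A \<in> sets S" and B: "B \<in> sets T" by simp_all
    have "(\<lambda>x. (X x, Y x)) -` (A \<times> B) \<inter> space M = (X -` A \<inter> space M) \<inter> (Y -` B \<inter> space M)"
      by auto
    then show "emeasure (distr M S X) A * emeasure (distr M T Y) B
        = emeasure (distr M (S \<Otimes>\<^sub>M T) (\<lambda>x. (X x, Y x))) (A \<times> B)"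
      using A B indep[OF A B] by (simp add: emeasure_distr emeasure_eq_measure ennreal_mult)
  qed (simp_all add: SX.sigma_finite_measure_axioms TY.sigma_finite_measure_axioms)
  note B [measurable] E [measurable]
  define D where "D = {z \<in> space (S \<Otimes>\<^sub>M T). R (fst z) (snd z) \<and> Q (snd z)}"
  have D: "D \<in> sets (S \<Otimes>\<^sub>M T)"
  proof -
    have "{z \<in> space (S \<Otimes>\<^sub>M T). Q (snd z)} = snd -` {y \<in> space T. Q y} \<inter> space (S \<Otimes>\<^sub>M T)"
      by (auto simp: space_pair_measure)
    moreover have "\<dots> \<in> sets (S \<Otimes>\<^sub>M T)" by (rule measurable_sets[OF measurable_snd E])
    ultimately show ?thesis unfolding D_def using B by (intro sets.sets_Collect_conj) auto
  qed
  have "{\<omega> \<in> space M. R (X \<omega>) (Y \<omega>) \<and> Q (Y \<omega>)} = (\<lambda>x. (X x, Y x)) -` D \<inter> space M"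
    using measurable_space[OF X] measurable_space[OF Y] by (auto simp: D_def space_pair_measure)
  then have "emeasure M {\<omega> \<in> space M. R (X \<omega>) (Y \<omega>) \<and> Q (Y \<omega>)}
      = emeasure (distr M S X \<Otimes>\<^sub>M distr M T Y) D"
    unfolding eq using D by (simp add: emeasure_distr)
  also have "\<dots> = (\<integral>\<^sup>+y. emeasure (distr M S X) ((\<lambda>x. (x, y)) -` D) \<partial>distr M T Y)"
    using D by (intro emeasure_pair_measure_alt2)
      (metis sets_distr sets_pair_measure_cong)
  also have "\<dots> \<le> (\<integral>\<^sup>+y. ennreal b * indicator {y \<in> space T. Q y} y \<partial>distr M T Y)"
  proof (rule nn_integral_mono)
    fix y assume "y \<in> space (distr M T Y)"
    then have y: "y \<in> space T" by simp
    have "(\<lambda>x. (x, y)) -` D \<in> sets S" using D by (rule sets_Pair2)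
    then have "emeasure (distr M S X) ((\<lambda>x. (x, y)) -` D)
        = emeasure M (X -` ((\<lambda>x. (x, y)) -` D) \<inter> space M)"
      by (simp add: emeasure_distr)
    also have "X -` ((\<lambda>x. (x, y)) -` D) \<inter> space M = {\<omega> \<in> space M. R (X \<omega>) y \<and> Q y}"
      using measurable_space[OF X] y by (auto simp: D_def space_pair_measure)
    \<comment> \<open>If \<open>Q y\<close> fails, the fibre is empty, in accordance with the
      indicator.\<close>
    also have "emeasure M \<dots> \<le> ennreal b * indicator {y \<in> space T. Q y} y"
      using bound[OF y] y by (cases "Q y") (auto simp: emeasure_eq_measure ennreal_leI)
    finally show "emeasure (distr M S X) ((\<lambda>x. (x, y)) -` D)
      \<le> ennreal b * indicator {y \<in> space T. Q y} y" .
  qed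
  also have "\<dots> = ennreal b * emeasure M (Y -` {y \<in> space T. Q y} \<inter> space M)"
    by (simp add: nn_integral_cmult emeasure_distr)
  also have "Y -` {y \<in> space T. Q y} \<inter> space M = {\<omega> \<in> space M. Q (Y \<omega>)}"
    using measurable_space[OF Y] by auto
  finally show ?thesis
    using b by (simp add: emeasure_eq_measure ennreal_mult[symmetric])
qed

text \<open>The finite sets of sites form a countable space, so measurability in a random aggregate
  can be checked for one fixed aggregate at a time.\<close>

abbreviation finite_sites :: "(int \<times> int) set measure" where
  "finite_sites \<equiv> count_space (Collect finite)"

abbreviation (input) x_axis :: "(int \<times> int) set" where
  "x_axis \<equiv> UNIV \<times> {0}"

lemma countable_finite_sites: "countable (Collect finite :: (int \<times> int) set set)"
  using countable_Collect_finite .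

lemma finite_send: "finite A \<Longrightarrow> finite (send w A)"
  by (simp add: send_def)

lemma card_send_le: "card (send w A) \<le> Suc (card A)"
  by (simp add: send_def card_insert_le_m1 card_insert_if)

lemma subset_send: "A \<subseteq> send w A"
  by (auto simp: send_def)

text \<open>The new site must be the one on the axis, and minimality of the stopping time keeps the
  path in \<open>A\<close> before. This replaces the stopping rule by an event to which the walk
  estimate applies.\<close>

lemma send_axis:
  assumes "send w A \<inter> x_axis \<noteq> {}" "A \<inter> x_axis = {}"
  shows "hits w A"
proof -
  have ex: "\<exists>t. w t \<notin> A" and ax: "insert (w (LEAST t. w t \<notin> A)) A \<inter> x_axis \<noteq> {}"
    using assms by (auto simp: send_def split: if_splits)
  have "w (LEAST t. w t \<notin> A) \<in> x_axis"
    using ax assms(2) by auto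
  moreover have "\<forall>s<(LEAST t. w t \<notin> A). w s \<in> A"
    using not_less_Least by blast
  ultimately show ?thesis unfolding hits_def by (metis mem_Times_iff singletonD)
qed

lemma measurable_send:
  assumes w: "\<And>t. (\<lambda>\<omega>. w \<omega> t) \<in> M \<rightarrow>\<^sub>M count_space UNIV"
    and a: "a \<in> M \<rightarrow>\<^sub>M finite_sites"
  shows "(\<lambda>\<omega>. send (w \<omega>) (a \<omega>)) \<in> M \<rightarrow>\<^sub>M finite_sites"
proof (rule measurable_compose_countable'[OF _ a countable_finite_sites])
  fix A :: "(int \<times> int) set" assume "A \<in> Collect finite"
  then have A: "finite A" by simp
  have P [measurable]: "Measurable.pred M (\<lambda>\<omega>. w \<omega> t \<notin> A)" for t
    by (rule measurable_compose[OF w]) simp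
  have "(\<lambda>\<omega>. w \<omega> (LEAST t. w \<omega> t \<notin> A)) \<in> M \<rightarrow>\<^sub>M count_space UNIV"
    by (rule measurable_compose_countable[where f = "\<lambda>t \<omega>. w \<omega> t", OF w]) measurable
  moreover have "(\<lambda>z. insert z A) \<in> count_space UNIV \<rightarrow>\<^sub>M finite_sites"
    using A by simp
  ultimately have ins: "(\<lambda>\<omega>. insert (w \<omega> (LEAST t. w \<omega> t \<notin> A)) A) \<in> M \<rightarrow>\<^sub>M finite_sites"
    by (rule measurable_compose)
  show "(\<lambda>\<omega>. send (w \<omega>) A) \<in> M \<rightarrow>\<^sub>M finite_sites"
    unfolding send_def using A by (intro measurable_If ins) auto
qed

text \<open>Flattens the levels into one list of particles, so that the union bound becomes an
  induction on that list.\<close>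

definition run :: "('p \<Rightarrow> nat \<Rightarrow> int \<times> int) \<Rightarrow> 'p list \<Rightarrow> (int \<times> int) set \<Rightarrow> (int \<times> int) set" where
  "run w ps = fold (\<lambda>p. send (w p)) ps"

lemma run_simps [simp]:
  "run w [] A = A"
  "run w (p # ps) A = run w ps (send (w p) A)"
  "run w (ps @ qs) A = run w qs (run w ps A)"
  by (simp_all add: run_def)

lemma run_cong: "(\<And>p. p \<in> set ps \<Longrightarrow> w p = w' p) \<Longrightarrow> run w ps A = run w' ps A"
  unfolding run_def by (metis fold_cong)

lemma finite_run: "finite A \<Longrightarrow> finite (run w ps A)"
  by (induction ps arbitrary: A) (auto intro: finite_send)

lemma card_run_le: "card (run w ps A) \<le> card A + length ps"
proof (induction ps arbitrary: A)
  case (Cons p ps)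
  show ?case using Cons[of "send (w p) A"] card_send_le[of "w p" A] by simp
qed simp

lemma measurable_run:
  assumes "\<And>p t. p \<in> set ps \<Longrightarrow> (\<lambda>\<omega>. w \<omega> p t) \<in> M \<rightarrow>\<^sub>M count_space UNIV"
    and "a \<in> M \<rightarrow>\<^sub>M finite_sites"
  shows "(\<lambda>\<omega>. run (w \<omega>) ps (a \<omega>)) \<in> M \<rightarrow>\<^sub>M finite_sites"
  using assms
proof (induction ps arbitrary: a)
  case (Cons p ps)
  then show ?case by (auto intro!: Cons.IH measurable_send)
qed simp

lemma measurable_path_space_component:
  assumes "p \<in> J" "f \<in> M \<rightarrow>\<^sub>M PiM J (\<lambda>_. path_space)"
  shows "(\<lambda>\<omega>. f \<omega> p t) \<in> M \<rightarrow>\<^sub>M count_space UNIV"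
  using measurable_compose[OF measurable_compose[OF assms(2) measurable_component_singleton[OF assms(1)]]
      measurable_component_singleton[of t UNIV "\<lambda>_. count_space UNIV"]] by simp

text \<open>The last path is independent of the aggregate built by the earlier ones, so that
  aggregate can be frozen. It has at most \<open>length ps\<close> sites, one per particle, and for
  such sets \<open>bound\<close> is available.\<close>

lemma (in prob_space) prob_run_snoc_axis:
  assumes indep: "indep_vars (\<lambda>_. path_space) X I"
    and ps: "distinct (ps @ [p])" "set (ps @ [p]) \<subseteq> I"
    and bound: "\<And>A. finite A \<Longrightarrow> card A \<le> length ps \<Longrightarrow> \<P>(\<omega> in M. hits (X p \<omega>) A) \<le> b"
  shows "\<P>(\<omega> in M. run (\<lambda>q. X q \<omega>) (ps @ [p]) {} \<inter> x_axis \<noteq> {})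
    \<le> \<P>(\<omega> in M. run (\<lambda>q. X q \<omega>) ps {} \<inter> x_axis \<noteq> {}) + b"
proof -
  have rv: "random_variable path_space (X q)" if "q \<in> I" for q
    using indep that by (auto simp: indep_vars_def)
  have Xt: "random_variable (count_space UNIV) (\<lambda>\<omega>. X q \<omega> t)" if "q \<in> I" for q t
    using measurable_compose[OF rv[OF that] measurable_component_singleton[of t]] by simp
  have meas: "random_variable finite_sites (\<lambda>\<omega>. run (\<lambda>q. X q \<omega>) qs {})" if "set qs \<subseteq> I" for qs
    using that Xt by (intro measurable_run) auto
  define Y where "Y \<omega> = run (\<lambda>q. X q \<omega>) ps {}" for \<omega>
  have Y: "random_variable finite_sites Y" unfolding Y_def using ps by (intro meas) auto
  have ev: "{\<omega> \<in> space M. run (\<lambda>q. X q \<omega>) qs {} \<inter> x_axis \<noteq> {}} \<in> events" if "set qs \<subseteq> I" for qs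
  proof -
    have "Measurable.pred finite_sites (\<lambda>A. A \<inter> x_axis \<noteq> {})" by simp
    from measurable_compose[OF meas[OF that] this] show ?thesis by (rule predE)
  qed
  let ?S = "PiM {p} (\<lambda>_. path_space)" and ?T = "PiM (set ps) (\<lambda>_. path_space)"
  let ?V = "\<lambda>\<omega>. restrict (\<lambda>i. X i \<omega>) {p}" and ?W = "\<lambda>\<omega>. restrict (\<lambda>i. X i \<omega>) (set ps)"
  have iv: "indep_var ?S ?V ?T ?W"
    using ps by (intro indep_var_restrict[OF indep]) auto
  have prod: "prob ((?V -` A \<inter> space M) \<inter> (?W -` B \<inter> space M))
      = prob (?V -` A \<inter> space M) * prob (?W -` B \<inter> space M)"
    if "A \<in> sets ?S" "B \<in> sets ?T" for A B
  proof -
    have "(?V -` A \<inter> space M) \<inter> (?W -` B \<inter> space M) = (\<lambda>\<omega>. (?V \<omega>, ?W \<omega>)) -` (A \<times> B) \<inter> space M"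
      by auto
    then show ?thesis using indep_varD[OF iv that] by simp
  qed
  \<comment> \<open>The earlier aggregate reads only the paths listed in \<open>ps\<close>, hence is
    a function of \<open>?W\<close>.\<close>
  have run_W: "run (?W \<omega>) ps {} = Y \<omega>" for \<omega>
    unfolding Y_def by (intro run_cong) simp
  have run_T: "(\<lambda>g. run g ps {}) \<in> ?T \<rightarrow>\<^sub>M finite_sites"
    by (intro measurable_run measurable_path_space_component[where J = "set ps"]) auto
  have hits_pair: "Measurable.pred N (\<lambda>z. hits (v z) (y z))"
    if v: "\<And>t. (\<lambda>z. v z t) \<in> N \<rightarrow>\<^sub>M count_space UNIV" and y: "y \<in> N \<rightarrow>\<^sub>M finite_sites"
    for N :: "'z measure" and v y
    by (rule measurable_compose_countable'[OF _ y countable_finite_sites]) (intro measurable_hits v)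
  have b: "0 \<le> b" using bound[of "{}"] measure_nonneg order_trans
    by (metis card.empty finite.emptyI zero_le)
  have hev: "{\<omega> \<in> space M. hits (X p \<omega>) (Y \<omega>)} \<in> events"
    using Xt ps Y by (intro predE hits_pair) auto
  have "\<P>(\<omega> in M. hits (?V \<omega> p) (run (?W \<omega>) ps {}) \<and> True) \<le> b * \<P>(\<omega> in M. True)"
  proof (rule prob_fibre_bound[where S = ?S and T = ?T and X = ?V and Y = ?W
        and R = "\<lambda>f g. hits (f p) (run g ps {})" and Q = "\<lambda>_. True"])
    show "random_variable ?S ?V" by (rule indep_var_rv1[OF iv])
    show "random_variable ?T ?W" by (rule indep_var_rv2[OF iv])
    show "{z \<in> space (?S \<Otimes>\<^sub>M ?T). hits (fst z p) (run (snd z) ps {})} \<in> sets (?S \<Otimes>\<^sub>M ?T)"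
      by (intro predE hits_pair measurable_path_space_component[where J = "{p}"]
          measurable_compose[OF measurable_snd run_T]) auto
    show "\<P>(\<omega> in M. hits (?V \<omega> p) (run g ps {})) \<le> b" for g
      using bound[of "run g ps {}"] finite_run[of "{}" g ps] card_run_le[of g ps "{}"] by simp
  qed (use prod b in auto)
  then have "\<P>(\<omega> in M. hits (X p \<omega>) (Y \<omega>)) \<le> b"
    unfolding run_W by (simp add: prob_space)
  moreover have "\<P>(\<omega> in M. run (\<lambda>q. X q \<omega>) (ps @ [p]) {} \<inter> x_axis \<noteq> {})
      \<le> prob ({\<omega> \<in> space M. Y \<omega> \<inter> x_axis \<noteq> {}} \<union> {\<omega> \<in> space M. hits (X p \<omega>) (Y \<omega>)})"
    using ev[of ps] hev ps send_axis unfolding Y_def by (intro finite_measure_mono) auto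
  moreover have "\<dots> \<le> \<P>(\<omega> in M. Y \<omega> \<inter> x_axis \<noteq> {}) + \<P>(\<omega> in M. hits (X p \<omega>) (Y \<omega>))"
    using ev[of ps] hev ps unfolding Y_def by (intro measure_Un_le) auto
  ultimately show ?thesis unfolding Y_def by linarith
qed

text \<open>Union bound over a block: one \<open>b\<close> serves every particle of
  \<open>bs\<close>, since its hypothesis allows for as many sites as the whole list can
  fill.\<close>

lemma (in prob_space) prob_run_append_axis:
  assumes indep: "indep_vars (\<lambda>_. path_space) X I"
    and "distinct (ps @ bs)" "set (ps @ bs) \<subseteq> I"
    and bound: "\<And>p A. p \<in> set bs \<Longrightarrow> finite A \<Longrightarrow> card A \<le> length (ps @ bs)
      \<Longrightarrow> \<P>(\<omega> in M. hits (X p \<omega>) A) \<le> b"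
  shows "\<P>(\<omega> in M. run (\<lambda>q. X q \<omega>) (ps @ bs) {} \<inter> x_axis \<noteq> {})
    \<le> \<P>(\<omega> in M. run (\<lambda>q. X q \<omega>) ps {} \<inter> x_axis \<noteq> {}) + real (length bs) * b"
  using assms(2-)
proof (induction bs rule: rev_induct)
  case (snoc p bs)
  have "\<P>(\<omega> in M. run (\<lambda>q. X q \<omega>) ((ps @ bs) @ [p]) {} \<inter> x_axis \<noteq> {})
      \<le> \<P>(\<omega> in M. run (\<lambda>q. X q \<omega>) (ps @ bs) {} \<inter> x_axis \<noteq> {}) + b"
    using snoc.prems by (intro prob_run_snoc_axis[OF indep]) auto
  also have "\<dots> \<le> \<P>(\<omega> in M. run (\<lambda>q. X q \<omega>) ps {} \<inter> x_axis \<noteq> {}) + real (length bs) * b + b"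
    using snoc.prems by (intro add_right_mono snoc.IH) auto
  finally show ?case by (simp add: algebra_simps)
qed simp

section \<open>The aggregate with deterministic numbers of particles\<close>

definition level_particles :: "(int \<Rightarrow> nat) \<Rightarrow> int \<Rightarrow> (int \<times> nat) list" where
  "level_particles k i = map (Pair i) [1..<Suc (k i)]"

text \<open>The two levels at the same distance are bracketed together to form one block for
  \<open>prob_run_append_axis\<close>.\<close>

primrec sending_order :: "(int \<Rightarrow> nat) \<Rightarrow> nat \<Rightarrow> (int \<times> nat) list" where
  "sending_order k 0 = level_particles k 0"
| "sending_order k (Suc m) = sending_order k m @
     (level_particles k (int (Suc m)) @ level_particles k (- int (Suc m)))"

lemma set_level_particles: "set (level_particles k i) = {i} \<times> {1..k i}"
  by (auto simp: level_particles_def)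

lemma set_sending_order: "set (sending_order k m) = (SIGMA i:{- int m..int m}. {1..k i})"
proof (induction m)
  case (Suc m)
  have "{- int (Suc m)..int (Suc m)} = insert (int (Suc m)) (insert (- int (Suc m)) {- int m..int m})"
    by auto
  then show ?case using Suc by (auto simp: set_level_particles simp del: of_nat_Suc)
qed (auto simp: set_level_particles)

lemma distinct_sending_order: "distinct (sending_order k m)"
proof (induction m)
  case (Suc m)
  then show ?case
    by (auto simp: set_sending_order set_level_particles level_particles_def distinct_map inj_on_def)
qed (simp add: level_particles_def distinct_map inj_on_def)

lemma length_sending_order: "length (sending_order k m) = (\<Sum>i\<in>{- int m..int m}. k i)"
proof -
  have "length (sending_order k m) = card (set (sending_order k m))"
    by (simp add: distinct_card distinct_sending_order)
  then show ?thesis by (simp add: set_sending_order)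
qed

lemma aggregate_eq_run: "aggregate w k m = run (\<lambda>(i, j). w i j) (sending_order k m) {}"
proof -
  have send_level: "send_level w k i A = run (\<lambda>(i, j). w i j) (level_particles k i) A" for i A
    by (simp add: send_level_def run_def level_particles_def fold_map comp_def)
  show ?thesis by (induction m) (simp_all add: send_level)
qed

lemma subset_run: "A \<subseteq> run w ps A"
  by (induction ps arbitrary: A) (auto dest: subsetD[OF subset_send] subsetD)

lemma aggregate_mono: "m \<le> m' \<Longrightarrow> aggregate w k m \<subseteq> aggregate w k m'"
proof (rule lift_Suc_mono_le[of "aggregate w k"])
  show "aggregate w k m \<subseteq> aggregate w k (Suc m)" for m
    unfolding aggregate_eq_run sending_order.simps run_simps
    by (rule subset_run[THEN order_trans], rule subset_run)
qed

text \<open>While the block at distance \<open>l\<close> is sent, the aggregate has at most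
  \<open>C * l\<close> sites, so each of its particles arrives with probability at most
  \<open>exp (- (real l * (1/4) ^ C))\<close>. Particles of level 0 would start on the axis; hence
  \<open>k 0 = 0\<close>.\<close>

lemma (in prob_space) prob_aggregate_axis_le:
  assumes walk: "\<And>i j. j \<ge> 1 \<Longrightarrow> simple_random_walk (S i j) (0, i)"
    and indep: "indep_vars (\<lambda>_. path_space) (\<lambda>(i, j) \<omega> t. S i j t \<omega>) particles"
    and k0: "k 0 = 0"
    and k: "\<And>m. 1 \<le> m \<Longrightarrow> length (sending_order k m) \<le> C * m"
  shows "\<P>(\<omega> in M. aggregate (\<lambda>i j t. S i j t \<omega>) k m \<inter> x_axis \<noteq> {})
    \<le> (\<Sum>l=1..m. real (k (int l) + k (- int l)) * exp (- (real l * (1/4) ^ C)))"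
proof -
  define X where "X = (\<lambda>(i, j) \<omega> t. S i j t \<omega>)"
  have indep': "indep_vars (\<lambda>_. path_space) X particles"
    using indep by (simp add: X_def)
  have agg: "aggregate (\<lambda>i j t. S i j t \<omega>) k m = run (\<lambda>p. X p \<omega>) (sending_order k m) {}" for m \<omega>
    unfolding aggregate_eq_run X_def by (intro run_cong) auto
  show ?thesis
  proof (induction m)
    case 0
    then show ?case by (simp add: send_level_def k0)
  next
    case (Suc m)
    let ?b = "exp (- (real (Suc m) * (1/4) ^ C))"
    let ?bs = "level_particles k (int (Suc m)) @ level_particles k (- int (Suc m))"
    have "\<P>(\<omega> in M. aggregate (\<lambda>i j t. S i j t \<omega>) k (Suc m) \<inter> x_axis \<noteq> {})
        = \<P>(\<omega> in M. run (\<lambda>p. X p \<omega>) (sending_order k m @ ?bs) {} \<inter> x_axis \<noteq> {})"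
      unfolding agg sending_order.simps ..
    also have "\<P>(\<omega> in M. run (\<lambda>p. X p \<omega>) (sending_order k m @ ?bs) {} \<inter> x_axis \<noteq> {})
      \<le> \<P>(\<omega> in M. run (\<lambda>p. X p \<omega>) (sending_order k m) {} \<inter> x_axis \<noteq> {}) + real (length ?bs) * ?b"
    proof (rule prob_run_append_axis[OF indep'])
      show "distinct (sending_order k m @ ?bs)"
        using distinct_sending_order[of k "Suc m"] by simp
      show "set (sending_order k m @ ?bs) \<subseteq> particles"
        using set_sending_order[of k "Suc m"] by auto
      fix p and A :: "(int \<times> int) set"
      assume p: "p \<in> set ?bs" and A: "finite A" "card A \<le> length (sending_order k m @ ?bs)"
      obtain i j where ij: "p = (i, j)" by (cases p)
      have i: "nat \<bar>i\<bar> = Suc m" and j: "1 \<le> j" using p ij by (auto simp: set_level_particles)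
      have "card A \<le> C * nat \<bar>i\<bar>" unfolding i using A(2) k[of "Suc m"] by simp
      from prob_hits_le[OF walk[OF j] A(1) this]
      show "\<P>(\<omega> in M. hits (X p \<omega>) A) \<le> ?b" unfolding i by (simp add: X_def ij)
    qed
    also have "length ?bs = k (int (Suc m)) + k (- int (Suc m))"
      by (simp add: level_particles_def)
    also have "\<P>(\<omega> in M. run (\<lambda>p. X p \<omega>) (sending_order k m) {} \<inter> x_axis \<noteq> {})
          + real (k (int (Suc m)) + k (- int (Suc m))) * ?b
        \<le> (\<Sum>l=1..m. real (k (int l) + k (- int l)) * exp (- (real l * (1/4) ^ C)))
          + real (k (int (Suc m)) + k (- int (Suc m))) * ?b"
      using Suc unfolding agg by (rule add_right_mono)
    also have "\<dots> = (\<Sum>l=1..Suc m. real (k (int l) + k (- int l)) * exp (- (real l * (1/4) ^ C)))"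
      by (simp del: of_nat_Suc)
    finally show ?case by simp
  qed
qed

text \<open>Up to a constant factor and a shift of the index, the series is the derivative of the
  geometric series at \<open>exp (- c)\<close>; the Cauchy criterion gives the tail.\<close>

lemma ex_small_exp_tail:
  fixes c :: real
  assumes "0 < c"
  shows "\<exists>L. \<forall>m. (\<Sum>l\<in>{L<..m}. real (C * l) * exp (- (real l * c))) \<le> 1/2"
proof -
  define x where "x = exp (- c)"
  have x: "norm x < 1" using assms by (simp add: x_def)
  have "summable (\<lambda>l. of_nat (Suc l) * x ^ l)"
    using geometric_deriv_sums[OF x] by (rule sums_summable)
  then have "summable (\<lambda>l. real C * x * (of_nat (Suc l) * x ^ l))" by (rule summable_mult)
  then have "summable (\<lambda>l. real (C * Suc l) * exp (- (real (Suc l) * c)))"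
    by (rule summable_cong[THEN iffD1, rotated])
       (auto simp: x_def exp_of_nat_mult[symmetric] exp_add[symmetric] algebra_simps)
  then have "summable (\<lambda>l. real (C * l) * exp (- (real l * c)))"
    by (subst (asm) summable_Suc_iff)
  then obtain L where L: "\<And>m n. m \<ge> L \<Longrightarrow>
      norm (\<Sum>l\<in>{m..<n}. real (C * l) * exp (- (real l * c))) < 1/2"
    unfolding summable_Cauchy by (metis half_gt_zero_iff zero_less_one)
  have "(\<Sum>l\<in>{L<..m}. real (C * l) * exp (- (real l * c))) \<le> 1/2" for m
  proof -
    have "{L<..m} = {Suc L..<Suc m}" by auto
    then show ?thesis using L[of "Suc L" "Suc m"] by auto
  qed
  then show ?thesis by blast
qed

text \<open>The order of sending depends on the random counts but takes countably many values, so it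
  suffices to run a fixed list.\<close>

lemma measurable_aggregate_axis_pair:
  "Measurable.pred (PiM particles (\<lambda>_. path_space) \<Otimes>\<^sub>M PiM UNIV (\<lambda>_. count_space UNIV))
    (\<lambda>z. \<exists>m. aggregate (\<lambda>i j. fst z (i, j)) (snd z) m \<inter> x_axis \<noteq> {})"
proof -
  let ?P = "PiM particles (\<lambda>_. path_space) \<Otimes>\<^sub>M PiM UNIV (\<lambda>_::int. count_space (UNIV :: nat set))"
  let ?Q = "PiM UNIV (\<lambda>_::int. count_space (UNIV :: nat set))"
  have level: "(\<lambda>k. level_particles k i) \<in> ?Q \<rightarrow>\<^sub>M count_space UNIV" for i
    unfolding level_particles_def
    by (rule measurable_compose[OF measurable_component_singleton[of i]]) simp_all
  have append: "(\<lambda>k. f k @ g k) \<in> ?Q \<rightarrow>\<^sub>M count_space UNIV"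
    if "f \<in> ?Q \<rightarrow>\<^sub>M count_space UNIV" "g \<in> ?Q \<rightarrow>\<^sub>M count_space UNIV" for f g :: "_ \<Rightarrow> (int \<times> nat) list"
    by (rule measurable_compose_countable[OF _ that(1)], rule measurable_compose[OF that(2)]) simp
  have order: "(\<lambda>k. sending_order k m) \<in> ?Q \<rightarrow>\<^sub>M count_space UNIV" for m
    by (induction m) (simp_all only: sending_order.simps level append)
  \<comment> \<open>The target is restricted to lists over \<open>particles\<close>, since the
    product space has a path only for these indices.\<close>
  have "(\<lambda>z. sending_order (snd z) m) \<in> ?P \<rightarrow>\<^sub>M count_space (lists particles)" for m
  proof -
    have "(\<lambda>z. sending_order (snd z) m) \<in> ?P \<rightarrow>\<^sub>M count_space UNIV"
      by (rule measurable_compose[OF measurable_snd order])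
    moreover have "sending_order k m \<in> lists particles" for k
      using set_sending_order[of k m] by auto
    ultimately show ?thesis unfolding measurable_count_space_eq2_countable by auto
  qed
  then have "(\<lambda>z. run (\<lambda>p. fst z p) (sending_order (snd z) m) {}) \<in> ?P \<rightarrow>\<^sub>M finite_sites" for m
  proof (rule measurable_compose_countable'[rotated])
    fix ps :: "(int \<times> nat) list" assume "ps \<in> lists particles"
    then show "(\<lambda>z. run (\<lambda>p. fst z p) ps {}) \<in> ?P \<rightarrow>\<^sub>M finite_sites"
      by (intro measurable_run measurable_path_space_component[OF _ measurable_fst]) auto
  qed simp
  from measurable_compose[OF this, of "\<lambda>A. A \<inter> x_axis \<noteq> {}" "count_space UNIV"]
  have "Measurable.pred ?P (\<lambda>z. aggregate (\<lambda>i j. fst z (i, j)) (snd z) m \<inter> x_axis \<noteq> {})" for m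
    by (simp add: aggregate_eq_run case_prod_beta)
  then show ?thesis by measurable
qed

section \<open>Numbers of particles that grow slowly\<close>

text \<open>The generating function \<open>exp (r * (z - 1))\<close> of the Poisson law at
  \<open>z = 2\<close>, which feeds the Chernoff bound.\<close>

lemma nn_integral_poisson_2_power:
  assumes "0 < r"
  shows "(\<integral>\<^sup>+x. ennreal (2 ^ x) \<partial>measure_pmf (poisson_pmf r)) = ennreal (exp r)"
proof -
  have "(\<lambda>x. (2 * r) ^ x /\<^sub>R fact x) sums exp (2 * r)" by (rule exp_converges)
  then have "(\<lambda>x. exp (- r) * ((2 * r) ^ x /\<^sub>R fact x)) sums (exp (- r) * exp (2 * r))"
    by (rule sums_mult)
  moreover have "(\<lambda>x. exp (- r) * ((2 * r) ^ x /\<^sub>R fact x)) = (\<lambda>x. pmf (poisson_pmf r) x * 2 ^ x)"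
    using assms by (simp add: fun_eq_iff power_mult_distrib field_simps)
  moreover have "exp (- r) * exp (2 * r) = exp r" by (simp add: exp_add[symmetric])
  ultimately have sums: "(\<lambda>x. pmf (poisson_pmf r) x * 2 ^ x) sums exp r" by (simp only:)
  have "(\<integral>\<^sup>+x. ennreal (2 ^ x) \<partial>measure_pmf (poisson_pmf r))
      = (\<Sum>x. ennreal (pmf (poisson_pmf r) x * 2 ^ x))"
    by (simp only: nn_integral_measure_pmf nn_integral_count_space_nat ennreal_mult pmf_nonneg
        zero_le_power zero_le_numeral)
  also have "\<dots> = ennreal (exp r)"
    by (rule suminf_ennreal_eq[OF _ sums]) simp
  finally show ?thesis .
qed

text \<open>The good event for the counts: linear growth bounds the size of the aggregate, and the
  empty levels leave only the tail of the union bound.\<close>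

definition sparse_counts :: "nat \<Rightarrow> nat \<Rightarrow> (int \<Rightarrow> nat) \<Rightarrow> bool" where
  "sparse_counts C L k \<longleftrightarrow> (\<forall>i. \<bar>i\<bar> \<le> int L \<longrightarrow> k i = 0) \<and>
     (\<forall>m\<ge>1. (\<Sum>i\<in>{- int m..int m}. k i) \<le> C * m)"

text \<open>Violations of the growth condition are measured inside the event \<open>Z\<close> that
  the inner levels are empty. Their probabilities keep the factor \<open>p = prob Z\<close> and add
  up to less than \<open>p\<close>, however small \<open>p\<close> is.\<close>

lemma (in prob_space) prob_sparse_counts_pos:
  fixes N :: "int \<Rightarrow> 'a \<Rightarrow> nat"
  assumes n: "1 \<le> n"
    and distr: "\<And>i. distr M (count_space UNIV) (N i) = measure_pmf (poisson_pmf (real n))"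
    and indep: "indep_vars (\<lambda>_. count_space UNIV) N UNIV"
  shows "0 < \<P>(\<omega> in M. sparse_counts (4 * n + 2) L (\<lambda>i. N i \<omega>))"
proof -
  have rv [measurable]: "N i \<in> M \<rightarrow>\<^sub>M count_space UNIV" for i
    using indep by (auto simp: indep_vars_def)
  define a where "a = exp (- real n)"
  define b where "b = exp (real n)"
  have ab: "0 < a" "1 \<le> b" by (simp_all add: a_def b_def)
  have law: "(\<integral>\<^sup>+\<omega>. f (N i \<omega>) \<partial>M) = (\<integral>\<^sup>+x. f x \<partial>measure_pmf (poisson_pmf (real n)))"
    for f :: "nat \<Rightarrow> ennreal" and i
    unfolding distr[of i, symmetric] by (subst nn_integral_distr) auto
  \<comment> \<open>One weight does both jobs: an indicator on the levels to be emptied and the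
    Chernoff weight \<open>2 ^ x\<close> beyond. Its means are the values of \<open>g\<close>, so
    the product up to \<open>L\<close> gives \<open>prob Z\<close> and longer products bound the
    violations within \<open>Z\<close>.\<close>
  define f :: "int \<Rightarrow> nat \<Rightarrow> ennreal" where
    "f i x = (if \<bar>i\<bar> \<le> int L then indicator {0} x else ennreal (2 ^ x))" for i x
  define g where "g i = (if \<bar>i\<bar> \<le> int L then a else b)" for i :: int
  have fN: "(\<integral>\<^sup>+\<omega>. f i (N i \<omega>) \<partial>M) = ennreal (g i)" for i
  proof -
    have "f i = (if \<bar>i\<bar> \<le> int L then indicator {0} else (\<lambda>x. ennreal (2 ^ x)))"
      by (auto simp: f_def fun_eq_iff)
    then show ?thesis
      unfolding law using n
      by (auto simp: g_def a_def b_def nn_integral_poisson_2_power emeasure_pmf_single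
          simp del: ennreal_power)
  qed
  have prod: "(\<integral>\<^sup>+\<omega>. (\<Prod>i\<in>{- int m..int m}. f i (N i \<omega>)) \<partial>M)
      = ennreal (\<Prod>i\<in>{- int m..int m}. g i)" for m
  proof -
    have "indep_vars (\<lambda>_. borel) (\<lambda>i \<omega>. f i (N i \<omega>)) UNIV"
      by (rule indep_vars_compose2[OF indep]) simp
    then have "indep_vars (\<lambda>_. borel) (\<lambda>i \<omega>. f i (N i \<omega>)) {- int m..int m}"
      by (rule indep_vars_subset) simp
    then have "(\<integral>\<^sup>+\<omega>. (\<Prod>i\<in>{- int m..int m}. f i (N i \<omega>)) \<partial>M)
        = (\<Prod>i\<in>{- int m..int m}. \<integral>\<^sup>+\<omega>. f i (N i \<omega>) \<partial>M)"
      by (intro indep_vars_nn_integral) auto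
    then show ?thesis
      using ab by (simp add: fN prod_ennreal g_def)
  qed
  define p where "p = (\<Prod>i\<in>{- int L..int L}. g i)"
  define Z where "Z = {\<omega> \<in> space M. \<forall>i\<in>{- int L..int L}. N i \<omega> = 0}"
  have Z_ev: "Z \<in> events" unfolding Z_def by measurable
  have p: "0 < p" unfolding p_def using ab by (intro prod_pos) (auto simp: g_def)
  have "emeasure M Z = (\<integral>\<^sup>+\<omega>. indicator Z \<omega> \<partial>M)" using Z_ev by simp
  also have "\<dots> = (\<integral>\<^sup>+\<omega>. (\<Prod>i\<in>{- int L..int L}. f i (N i \<omega>)) \<partial>M)"
  proof (rule nn_integral_cong)
    fix \<omega> assume \<omega>: "\<omega> \<in> space M"
    show "indicator Z \<omega> = (\<Prod>i\<in>{- int L..int L}. f i (N i \<omega>))"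
    proof (cases "\<omega> \<in> Z")
      case True
      then have "f i (N i \<omega>) = 1" if "i \<in> {- int L..int L}" for i
        using that by (auto simp: Z_def f_def)
      then show ?thesis using True by simp
    next
      case False
      then obtain i where "i \<in> {- int L..int L}" "N i \<omega> \<noteq> 0" using \<omega> by (auto simp: Z_def)
      moreover from this have "f i (N i \<omega>) = 0" by (auto simp: f_def)
      ultimately have "(\<Prod>i\<in>{- int L..int L}. f i (N i \<omega>)) = 0"
        by (intro prod_zero) auto
      then show ?thesis using False by simp
    qed
  qed
  also have "\<dots> = ennreal p" unfolding prod p_def ..
  finally have probZ: "prob Z = p" using p by (simp add: emeasure_eq_measure)
  define B where "B m = {\<omega> \<in> Z. (4 * n + 2) * m < (\<Sum>i\<in>{- int m..int m}. N i \<omega>)}" for m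
  have B_ev: "B m \<in> events" for m
  proof -
    have "B m = Z \<inter> {\<omega> \<in> space M. (4 * n + 2) * m < (\<Sum>i\<in>{- int m..int m}. N i \<omega>)}"
      by (auto simp: B_def Z_def)
    then show ?thesis using Z_ev by simp
  qed
  text \<open>The Chernoff bound with base \<open>2\<close>, restricted to \<open>Z\<close>: as \<open>e\<^sup>2\<^sup>n \<le> 2\<^sup>4\<^sup>n\<close>, the choice
    \<open>4n + 2\<close> leaves a factor \<open>2\<^sup>-\<^sup>2\<^sup>m\<close>.\<close>
  have probB: "prob (B m) \<le> p * (1/4) ^ m" for m
  proof (cases "m \<le> L")
    case True
    have "B m = {}"
    proof -
      have "(\<Sum>i\<in>{- int m..int m}. N i \<omega>) = 0" if "\<omega> \<in> Z" for \<omega>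
        using that True by (auto simp: Z_def)
      then show ?thesis by (auto simp: B_def)
    qed
    then show ?thesis using p by simp
  next
    case False
    \<comment> \<open>Markov's inequality: on \<open>B m\<close> the product of weights is 2 to the
      total count, the inner counts being 0.\<close>
    have "emeasure M (B m) * ennreal (2 ^ ((4 * n + 2) * m))
        = (\<integral>\<^sup>+\<omega>. ennreal (2 ^ ((4 * n + 2) * m)) * indicator (B m) \<omega> \<partial>M)"
      using B_ev[of m] by (subst nn_integral_cmult_indicator) (simp_all only: mult.commute)
    also have "\<dots> \<le> (\<integral>\<^sup>+\<omega>. (\<Prod>i\<in>{- int m..int m}. f i (N i \<omega>)) \<partial>M)"
    proof (rule nn_integral_mono)
      fix \<omega> assume "\<omega> \<in> space M"
      show "ennreal (2 ^ ((4 * n + 2) * m)) * indicator (B m) \<omega>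
          \<le> (\<Prod>i\<in>{- int m..int m}. f i (N i \<omega>))"
      proof (cases "\<omega> \<in> B m")
        case True
        have "f i (N i \<omega>) = ennreal (2 ^ N i \<omega>)" for i
        proof (cases "\<bar>i\<bar> \<le> int L")
          case i: True
          have "i \<in> {- int L..int L}" using i by auto
          then have "N i \<omega> = 0" using True unfolding B_def Z_def by blast
          then show ?thesis by (simp add: f_def)
        qed (simp add: f_def)
        then have "(\<Prod>i\<in>{- int m..int m}. f i (N i \<omega>))
            = ennreal (2 ^ (\<Sum>i\<in>{- int m..int m}. N i \<omega>))"
          by (simp add: prod_ennreal power_sum)
        moreover have "(2::real) ^ ((4 * n + 2) * m) \<le> 2 ^ (\<Sum>i\<in>{- int m..int m}. N i \<omega>)"
          using True by (intro power_increasing) (auto simp: B_def)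
        ultimately show ?thesis using True by (simp add: ennreal_leI del: ennreal_power)
      qed simp
    qed
    also have "\<dots> = ennreal (\<Prod>i\<in>{- int m..int m}. g i)" by (rule prod)
    also have "(\<Prod>i\<in>{- int m..int m}. g i) = p * (\<Prod>i\<in>{- int m..int m} - {- int L..int L}. g i)"
      unfolding p_def using False by (subst prod.subset_diff[of "{- int L..int L}"])
        (auto simp: mult.commute)
    also have "(\<Prod>i\<in>{- int m..int m} - {- int L..int L}. g i) = b ^ (2 * m - 2 * L)"
    proof -
      have "(\<Prod>i\<in>{- int m..int m} - {- int L..int L}. g i)
          = (\<Prod>i\<in>{- int m..int m} - {- int L..int L}. b)"
        by (intro prod.cong) (auto simp: g_def)
      moreover have "card ({- int m..int m} - {- int L..int L}) = 2 * m - 2 * L"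
        using False by (subst card_Diff_subset) auto
      ultimately show ?thesis by simp
    qed
    finally have "prob (B m) * 2 ^ ((4 * n + 2) * m) \<le> p * b ^ (2 * m - 2 * L)"
      using p ab by (simp add: emeasure_eq_measure ennreal_mult[symmetric] del: ennreal_power)
    also have "\<dots> \<le> p * b ^ (2 * m)"
      using p ab by (intro mult_left_mono power_increasing) auto
    also have "b ^ (2 * m) \<le> 2 ^ (4 * n * m)"
    proof -
      have "exp 1 \<le> (4::real)" using exp_le by simp
      then have "exp 1 ^ (2 * n * m) \<le> (4::real) ^ (2 * n * m)" by (intro power_mono) auto
      also have "\<dots> = 2 ^ (4 * n * m)"
        using power_mult[of "2::real" 2 "2 * n * m"] by (simp add: mult_ac)
      also have "exp 1 ^ (2 * n * m) = b ^ (2 * m)"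
        by (simp add: b_def exp_of_nat_mult[symmetric] mult_ac)
      finally show ?thesis .
    qed
    finally have "prob (B m) * 2 ^ ((4 * n + 2) * m) \<le> p * 2 ^ (4 * n * m)"
      using p by simp
    moreover have "(2::real) ^ ((4 * n + 2) * m) = 2 ^ (4 * n * m) * 4 ^ m"
    proof -
      have "(4 * n + 2) * m = 4 * n * m + 2 * m" by (simp add: algebra_simps)
      then show ?thesis by (simp add: power_add power_mult[of "2::real" 2 m])
    qed
    ultimately show ?thesis by (simp add: field_simps power_divide)
  qed
  define Q where "Q = {\<omega> \<in> space M. sparse_counts (4 * n + 2) L (\<lambda>i. N i \<omega>)}"
  have QZ: "Z - (\<Union>m. B (Suc m)) \<subseteq> Q"
  proof
    fix \<omega> assume \<omega>: "\<omega> \<in> Z - (\<Union>m. B (Suc m))"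
    have "(\<Sum>i\<in>{- int m..int m}. N i \<omega>) \<le> (4 * n + 2) * m" if m: "1 \<le> m" for m
    proof -
      obtain m' where "m = Suc m'" using m by (cases m) auto
      then show ?thesis using \<omega> by (auto simp: B_def not_less simp del: of_nat_Suc)
    qed
    moreover have "N i \<omega> = 0" if "\<bar>i\<bar> \<le> int L" for i
    proof -
      have "i \<in> {- int L..int L}" using that by auto
      then show ?thesis using \<omega> unfolding Z_def by blast
    qed
    moreover have "\<omega> \<in> space M" using \<omega> by (simp add: Z_def)
    ultimately show "\<omega> \<in> Q" by (simp add: Q_def sparse_counts_def)
  qed
  \<comment> \<open>Starting at \<open>m = 1\<close> the series sums to \<open>p / 3 < p\<close>; a
    term for \<open>m = 0\<close> would already equal \<open>p\<close>.\<close>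
  have geom: "(\<lambda>m. p * (1/4) ^ Suc m) sums (p / 3)"
    using sums_mult[OF geometric_sums[of "1/4::real"], of "p / 4"] by (simp add: field_simps)
  have summ: "summable (\<lambda>m. prob (B (Suc m)))"
    by (rule summable_comparison_test'[OF sums_summable[OF geom]])
      (use probB in \<open>auto simp del: power_Suc\<close>)
  have "prob (\<Union>m. B (Suc m)) \<le> (\<Sum>m. prob (B (Suc m)))"
    using B_ev summ by (intro finite_measure_subadditive_countably) auto
  also have "\<dots> \<le> (\<Sum>m. p * (1/4) ^ Suc m)"
    by (intro suminf_le summ sums_summable[OF geom] probB)
  also have "\<dots> = p / 3" using geom by (rule sums_unique[symmetric])
  finally have "0 < prob Z - prob (\<Union>m. B (Suc m))" using p probZ by simp
  also have "\<dots> = prob (Z - (\<Union>m. B (Suc m)))"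
    using B_ev Z_ev by (intro finite_measure_Diff[symmetric]) (auto simp: B_def)
  also have "\<dots> \<le> prob Q"
  proof (rule finite_measure_mono[OF QZ])
    show "Q \<in> events" unfolding Q_def sparse_counts_def by measurable
  qed
  finally show ?thesis unfolding Q_def .
qed

section \<open>Averaging the axis estimate over the particle numbers\<close>

theorem proposition3p6:
  fixes M :: "'a measure"
    and S :: "int \<Rightarrow> nat \<Rightarrow> nat \<Rightarrow> 'a \<Rightarrow> int \<times> int"
    and N :: "int \<Rightarrow> 'a \<Rightarrow> nat"
    and n :: nat
  assumes "prob_space M"
    and "n \<ge> 1"
    and "\<And>i j. j \<ge> 1 \<Longrightarrow> prob_space.simple_random_walk M (S i j) (0, i)"
    and "prob_space.indep_vars M (\<lambda>_. path_space) (\<lambda>(i, j) \<omega> t. S i j t \<omega>) particles"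
    and "\<And>i. distr M (count_space UNIV) (N i) = measure_pmf (poisson_pmf (real n))"
    and "prob_space.indep_vars M (\<lambda>_. count_space UNIV) N UNIV"
    and "prob_space.indep_set M
           (sets (vimage_algebra (space M) (\<lambda>\<omega>. \<lambda>(i, j)\<in>particles. \<lambda>t. S i j t \<omega>)
                    (PiM particles (\<lambda>_. path_space))))
           (sets (vimage_algebra (space M) (\<lambda>\<omega> i. N i \<omega>)
                    (PiM UNIV (\<lambda>_. count_space UNIV))))"
  shows "measure M {\<omega> \<in> space M.
           aggregate_inf (\<lambda>i j t. S i j t \<omega>) (\<lambda>i. N i \<omega>) \<inter> (UNIV \<times> {0}) = {}} > 0"
proof -
  interpret prob_space M by fact
  \<comment> \<open>The growth constant for which the counts are sparse with positive probability.
    It is fixed first; \<open>L\<close> is then chosen so large that the tail belonging to this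
    \<open>C\<close> is at most 1/2.\<close>
  define C where "C = 4 * n + 2"
  obtain L where L: "\<And>m. (\<Sum>l\<in>{L<..m}. real (C * l) * exp (- (real l * (1/4) ^ C))) \<le> 1/2"
    using ex_small_exp_tail[of "(1/4) ^ C" C] by auto
  let ?P = "PiM particles (\<lambda>_. path_space)"
    and ?Q = "PiM UNIV (\<lambda>_::int. count_space (UNIV :: nat set))"
  \<comment> \<open>The family of paths cut down to \<open>particles\<close>, as an element of the
    product space; the aggregates do not see the difference.\<close>
  define W where "W \<omega> = (\<lambda>(i, j)\<in>particles. \<lambda>t. S i j t \<omega>)" for \<omega>
  define K where "K \<omega> = (\<lambda>i. N i \<omega>)" for \<omega>
  define hit where "hit f k \<longleftrightarrow> (\<exists>m. aggregate (\<lambda>i j. f (i, j)) k m \<inter> x_axis \<noteq> {})"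
    for f :: "int \<times> nat \<Rightarrow> nat \<Rightarrow> int \<times> int" and k
  have W: "random_variable ?P W"
    unfolding W_def using assms(4) by (intro measurable_restrict) (auto simp: indep_vars_def)
  have K: "random_variable ?Q K"
    unfolding K_def using assms(6) by (intro measurable_PiM_single') (auto simp: indep_vars_def)
  have agg: "aggregate (\<lambda>i j. W \<omega> (i, j)) k m = aggregate (\<lambda>i j t. S i j t \<omega>) k m" for \<omega> k m
    unfolding aggregate_eq_run
    by (intro run_cong) (auto simp: W_def set_sending_order)
  have hit_pair: "Measurable.pred (?P \<Otimes>\<^sub>M ?Q) (\<lambda>z. hit (fst z) (snd z))"
    unfolding hit_def by (rule measurable_aggregate_axis_pair)
  have hit_ev: "{\<omega> \<in> space M. hit (W \<omega>) (K \<omega>)} \<in> events"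
    using measurable_compose[OF measurable_Pair[OF W K] hit_pair] by (simp add: predE)
  have sparse: "{k \<in> space ?Q. sparse_counts C L k} \<in> sets ?Q"
    unfolding sparse_counts_def by measurable
  have [measurable]: "N i \<in> M \<rightarrow>\<^sub>M count_space UNIV" for i
    using assms(6) by (auto simp: indep_vars_def)
  have sparse_ev: "{\<omega> \<in> space M. sparse_counts C L (K \<omega>)} \<in> events"
    unfolding sparse_counts_def K_def by measurable
  have "\<P>(\<omega> in M. hit (W \<omega>) k) \<le> 1/2" if k: "sparse_counts C L k" for k
  proof -
    let ?E = "\<lambda>m. {\<omega> \<in> space M. aggregate (\<lambda>i j t. S i j t \<omega>) k m \<inter> x_axis \<noteq> {}}"
    have k0: "k 0 = 0" and len: "length (sending_order k m) \<le> C * m" if "1 \<le> m" for m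
      using k that by (auto simp: sparse_counts_def length_sending_order)
    have E_le: "prob (?E m) \<le> 1/2" for m
    proof -
      have "prob (?E m)
          \<le> (\<Sum>l=1..m. real (k (int l) + k (- int l)) * exp (- (real l * (1/4) ^ C)))"
        using k0 len by (intro prob_aggregate_axis_le assms) auto
      \<comment> \<open>The levels up to \<open>L\<close> are empty and drop out of the sum.\<close>
      also have "\<dots> = (\<Sum>l\<in>{L<..m}. real (k (int l) + k (- int l)) * exp (- (real l * (1/4) ^ C)))"
        using k by (intro sum.mono_neutral_right) (auto simp: sparse_counts_def)
      also have "\<dots> \<le> (\<Sum>l\<in>{L<..m}. real (C * l) * exp (- (real l * (1/4) ^ C)))"
      proof (intro sum_mono mult_right_mono)
        fix l assume l: "l \<in> {L<..m}"
        \<comment> \<open>The two levels are distinct because \<open>l > L\<close>, and both belong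
          to the total controlled by the growth condition.\<close>
        have "k (int l) + k (- int l) = (\<Sum>i\<in>{int l, - int l}. k i)" using l by simp
        also have "\<dots> \<le> (\<Sum>i\<in>{- int l..int l}. k i)" by (intro sum_mono2) auto
        also have "\<dots> \<le> C * l" using k l by (auto simp: sparse_counts_def)
        finally show "real (k (int l) + k (- int l)) \<le> real (C * l)" by (simp only: of_nat_le_iff)
      qed simp
      also have "\<dots> \<le> 1/2" by (rule L)
      finally show ?thesis .
    qed
    have E_ev: "?E m \<in> events" for m
    proof -
      have "(\<lambda>\<omega>. run (\<lambda>p. W \<omega> p) (sending_order k m) {}) \<in> M \<rightarrow>\<^sub>M finite_sites"
        using W by (intro measurable_run measurable_path_space_component[where J = particles])
          (auto simp: set_sending_order)
      from measurable_compose[OF this, of "\<lambda>A. A \<inter> x_axis \<noteq> {}" "count_space UNIV"]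
      have "Measurable.pred M (\<lambda>\<omega>. aggregate (\<lambda>i j. W \<omega> (i, j)) k m \<inter> x_axis \<noteq> {})"
        by (simp add: aggregate_eq_run case_prod_beta)
      then show ?thesis unfolding agg by (rule predE)
    qed
    have "(\<lambda>m. prob (?E m)) \<longlonglongrightarrow> prob (\<Union>m. ?E m)"
    proof (rule finite_Lim_measure_incseq)
      show "range ?E \<subseteq> events" using E_ev by blast
      show "incseq ?E"
        unfolding incseq_def using aggregate_mono by blast
    qed
    then have "prob (\<Union>m. ?E m) \<le> 1/2"
      using E_le by (intro LIMSEQ_le_const2) auto
    moreover have "{\<omega> \<in> space M. hit (W \<omega>) k} = (\<Union>m. ?E m)"
      unfolding hit_def agg by auto
    ultimately show ?thesis by simp
  qed
  then have "\<P>(\<omega> in M. hit (W \<omega>) (K \<omega>) \<and> sparse_counts C L (K \<omega>))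
      \<le> 1/2 * \<P>(\<omega> in M. sparse_counts C L (K \<omega>))"
  proof (intro prob_fibre_bound[where S = ?P and T = ?Q and X = W and Y = K] W K sparse)
    show "prob ((W -` A \<inter> space M) \<inter> (K -` B \<inter> space M))
        = prob (W -` A \<inter> space M) * prob (K -` B \<inter> space M)"
      if "A \<in> sets ?P" "B \<in> sets ?Q" for A B
      using assms(7) unfolding W_def[symmetric, abs_def] K_def[symmetric, abs_def]
      by (rule indep_setD) (use that in \<open>auto intro: in_vimage_algebra\<close>)
  qed (use hit_pair in \<open>auto intro: predE\<close>)
  moreover have "0 < \<P>(\<omega> in M. sparse_counts C L (K \<omega>))"
    using prob_sparse_counts_pos[OF assms(2,5,6), of L] by (simp add: C_def K_def)
  \<comment> \<open>Together with the fibre bound this leaves at least half the probability of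
    sparse counts for the event that the axis is missed.\<close>
  moreover have "\<P>(\<omega> in M. sparse_counts C L (K \<omega>))
      \<le> \<P>(\<omega> in M. \<not> hit (W \<omega>) (K \<omega>)) + \<P>(\<omega> in M. hit (W \<omega>) (K \<omega>) \<and> sparse_counts C L (K \<omega>))"
  proof -
    have 1: "{\<omega> \<in> space M. \<not> hit (W \<omega>) (K \<omega>)} \<in> events"
      using hit_ev by (rule sets.sets_Collect_neg)
    have 2: "{\<omega> \<in> space M. hit (W \<omega>) (K \<omega>) \<and> sparse_counts C L (K \<omega>)} \<in> events"
      using hit_ev sparse_ev by (intro sets.sets_Collect_conj)
    have "\<P>(\<omega> in M. sparse_counts C L (K \<omega>))
        \<le> prob ({\<omega> \<in> space M. \<not> hit (W \<omega>) (K \<omega>)}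
          \<union> {\<omega> \<in> space M. hit (W \<omega>) (K \<omega>) \<and> sparse_counts C L (K \<omega>)})"
      using 1 2 by (intro finite_measure_mono) auto
    also have "\<dots> \<le> \<P>(\<omega> in M. \<not> hit (W \<omega>) (K \<omega>))
        + \<P>(\<omega> in M. hit (W \<omega>) (K \<omega>) \<and> sparse_counts C L (K \<omega>))"
      using 1 2 by (rule measure_Un_le)
    finally show ?thesis .
  qed
  ultimately have "0 < \<P>(\<omega> in M. \<not> hit (W \<omega>) (K \<omega>))" by linarith
  also have "{\<omega> \<in> space M. \<not> hit (W \<omega>) (K \<omega>)} = {\<omega> \<in> space M.
      aggregate_inf (\<lambda>i j t. S i j t \<omega>) (\<lambda>i. N i \<omega>) \<inter> x_axis = {}}"
    unfolding hit_def agg aggregate_inf_def K_def by auto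
  finally show ?thesis .
qed

end
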